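(* Let a planar quadrilateral mesh with $G^1$-smooth piecewise-cubic boundary, satisfying the assumptions below, be given with its global in-plane parametrisation $\tilde\Pi^{(bicubic)}$. For any $n\ge5$ and for any type of "additional" constraints (listed in the context) there exists a minimal determining set of control points for $\mathcal F^{(n)}$ that fits the additional constraints.
   Context: Mesh: $\Omega$ is a planar simply-connected domain subdivided into finitely many quadrilateral elements, any two being disjoint or sharing exactly a common vertex or edge. Inner edges are straight segments; boundary edges are cubic B\'ezier curves, consecutive boundary edges joining with (non-degenerate) $G^1$-smoothness (nonzero tangent vectors of the same direction at the common vertex). The four vertices of each element form a strictly convex quadrilateral. Every boundary vertex has exactly one adjacent inner edge (valence $3$); every inner edge has at most one boundary vertex. Parametrisation $\tilde\Pi^{(bicubic)}$: an inner element (no boundary edge) with vertices $A,B,C,D$ has the bilinear parametrisation $A(1-u)(1-v)+Bu(1-v)+Cuv+D(1-u)v$. A boundary element with inner vertices $A,B$ and boundary vertices $C,D$ (cyclic order $A,B,C,D$) and boundary curve control points $D,E,F,C$ has $\tilde P=\sum_{i,j=0}^3\tilde P_{ij}B_i^3(u)B_j^3(v)$, where rows $j=0,1$ and $\tilde P_{02},\tilde P_{32}$ come from degree elevation of the bilinear map ($\tilde P(0,0)=A,\tilde P(1,0)=B,\tilde P(1,1)=C,\tilde P(0,1)=D$), $\tilde P_{12}=\frac19(2A+B+C+2D+3E)$, $\tilde P_{22}=\frac19(A+2B+2C+D+3F)$, $\tilde P_{03},\tilde P_{13},\tilde P_{23},\tilde P_{33}=D,E,F,C$. All these parametrisations are assumed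 regular (bijective onto the element, Jacobian nowhere zero on $[0,1]^2$). $\mathcal F^{(n)}$ is the vector space of functions $Z\in C^1(\Omega)$ which on each element, in its parameters, have the form $\sum_{i,j=0}^nZ_{ij}B^n_i(u)B^n_j(v)$, $B^n_i(t)=\binom nit^i(1-t)^{n-i}$. Control points are the index positions $(i,j)$ of all elements, positions along a common edge being identified; $Z(p)$ is the coefficient of $Z$ at $p$. A determining set is a set $D$ of control points such that $Z\in\mathcal F^{(n)}$, $Z(p)=0\ \forall p\in D$ imply $Z\equiv0$; a minimal determining set (MDS) is a determining set of smallest cardinality. If $\mathcal B$ is an MDS, each $Z(p)$ is a unique linear function of the values $Z(b)$, $b\in\mathcal B$. An additional constraint prescribes the values of $Z$ (consistently with $C^1$-smoothness) at a set $F$ of fixed control points. The types are: vertex interpolation ($F$ = control points at all mesh vertices), optionally together with tangent plane interpolation ($F$ additionally contains, for every mesh vertex, the first control points next to it along all mesh edges at it) and/or boundary curve interpolation ($F$ additionally contains all control points on $\partial\Omega$); simply-supported boundary condition ($F$ = all control points on $\partial\Omega$); clamped boundary condition ($F$ = all control points on $\partial\Omega$ and all control points in the rows adjacent to boundary edges of boundary elements). An MDS $\mathcal B$ fits the constraint if every $p\in F$ either belongs to $\mathcal B$ or $Z(p)$ depends only on the values $Z(b)$ with $b\in\mathcal B\cap F$. *)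

theory Defs
  imports "HOL-Analysis.Analysis"
begin

type_synonym point = "real^2"

text \<open>
  The corners of an element are numbered \<open>0, 1, 2, 3\<close> in cyclic order (\<open>A, B, C, D\<close>), and edge \<open>i\<close>
  runs from corner \<open>i\<close> to corner \<open>i + 1\<close> (mod 4). The order may be clockwise or counterclockwise.
  \<open>bcurve M k = Some (E, F)\<close> marks \<open>k\<close> as a boundary element. Its labelling is then chosen such that
  edge 2 is the boundary edge, a cubic Bezier curve with control points \<open>D, E, F, C\<close>.
\<close>

record 'e mesh =
  elems :: "'e set"
  corner :: "'e \<Rightarrow> nat \<Rightarrow> point"
  bcurve :: "'e \<Rightarrow> (point \<times> point) option"

definition next_corner :: "nat \<Rightarrow> nat" where
  "next_corner i = Suc i mod 4"

definition bilinear_map :: "'e mesh \<Rightarrow> 'e \<Rightarrow> real \<Rightarrow> real \<Rightarrow> point" where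
  "bilinear_map M k u v =
     ((1 - u) * (1 - v)) *\<^sub>R corner M k 0 + (u * (1 - v)) *\<^sub>R corner M k 1
     + (u * v) *\<^sub>R corner M k 2 + ((1 - u) * v) *\<^sub>R corner M k 3"

text \<open>
  In the last case the control point is that of the bilinear map elevated to degree \<open>(3, 3)\<close>, which
  is the value of the bilinear map at \<open>(i/3, j/3)\<close>.
\<close>

definition bicubic_net :: "'e mesh \<Rightarrow> 'e \<Rightarrow> nat \<Rightarrow> nat \<Rightarrow> point" where
  "bicubic_net M k i j =
     (let A = corner M k 0; B = corner M k 1; C = corner M k 2; D = corner M k 3;
          (E, F) = the (bcurve M k)
      in if j = 3 then [D, E, F, C] ! i
         else if j = 2 \<and> i = 1 then (1 / 9) *\<^sub>R (2 *\<^sub>R A + B + C + 2 *\<^sub>R D + 3 *\<^sub>R E)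
         else if j = 2 \<and> i = 2 then (1 / 9) *\<^sub>R (A + 2 *\<^sub>R B + 2 *\<^sub>R C + D + 3 *\<^sub>R F)
         else bilinear_map M k (real i / 3) (real j / 3))"

definition parametrisation :: "'e mesh \<Rightarrow> 'e \<Rightarrow> real^2 \<Rightarrow> point" where
  "parametrisation M k w =
     (if bcurve M k = None then bilinear_map M k (w $ 1) (w $ 2)
      else \<Sum>i\<le>3. \<Sum>j\<le>3. (Bernstein 3 i (w $ 1) * Bernstein 3 j (w $ 2)) *\<^sub>R bicubic_net M k i j)"

definition edge :: "'e mesh \<Rightarrow> 'e \<Rightarrow> nat \<Rightarrow> point set" where
  "edge M k i =
     (if bcurve M k \<noteq> None \<and> i = 2
      then (\<lambda>t. \<Sum>m\<le>3. Bernstein 3 m t *\<^sub>R bicubic_net M k m 3) ` {0..1}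
      else closed_segment (corner M k i) (corner M k (next_corner i)))"

definition outline :: "'e mesh \<Rightarrow> 'e \<Rightarrow> point set" where
  "outline M k = (\<Union>i<4. edge M k i)"

definition element :: "'e mesh \<Rightarrow> 'e \<Rightarrow> point set" where
  "element M k = outline M k \<union> inside (outline M k)"

text \<open>\<open>\<Omega>\<close> is taken closed, including its boundary; the open domain is its interior.\<close>

definition Omega :: "'e mesh \<Rightarrow> point set" where
  "Omega M = (\<Union>k\<in>elems M. element M k)"

definition boundary_edge :: "'e mesh \<Rightarrow> 'e \<Rightarrow> nat \<Rightarrow> bool" where
  "boundary_edge M k i \<longleftrightarrow> edge M k i \<subseteq> frontier (Omega M)"

definition vertices :: "'e mesh \<Rightarrow> point set" where
  "vertices M = {corner M k i | k i. k \<in> elems M \<and> i < 4}"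

definition edges_at :: "'e mesh \<Rightarrow> point \<Rightarrow> point set set" where
  "edges_at M p = {edge M k i | k i. k \<in> elems M \<and> i < 4 \<and> p \<in> {corner M k i, corner M k (next_corner i)}}"

definition inner_edges_at :: "'e mesh \<Rightarrow> point \<Rightarrow> point set set" where
  "inner_edges_at M p = {edge M k i | k i. k \<in> elems M \<and> i < 4 \<and> \<not> boundary_edge M k i
     \<and> p \<in> {corner M k i, corner M k (next_corner i)}}"

text \<open>
  Up to the factor 3, the derivative of the boundary curve at its endpoint \<open>corner M k i\<close>
  (\<open>i = 2, 3\<close>), directed from that endpoint into the curve.
\<close>

definition bd_tangent :: "'e mesh \<Rightarrow> 'e \<Rightarrow> nat \<Rightarrow> real^2" where
  "bd_tangent M k i =
     (case the (bcurve M k) of (E, F) \<Rightarrow> if i = 3 then E - corner M k 3 else F - corner M k 2)"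

definition turn :: "point \<Rightarrow> point \<Rightarrow> point \<Rightarrow> real" where
  "turn p q r = det (vector [q - p, r - q] :: real^2^2)"

text \<open>All interior angles lie strictly between \<open>0\<close> and \<open>\<pi>\<close>: four strict turns in the same direction.\<close>

definition strictly_convex_quad :: "(nat \<Rightarrow> point) \<Rightarrow> bool" where
  "strictly_convex_quad q \<longleftrightarrow>
     (\<exists>s\<in>{-1, 1}. \<forall>i<4. 0 < s * turn (q i) (q (next_corner i)) (q (next_corner (next_corner i))))"

locale quad_mesh =
  fixes M :: "'e mesh"
  assumes finite_elems: "finite (elems M)"
    and elems_nonempty: "elems M \<noteq> {}"
    and simply_connected_domain: "simply_connected (interior (Omega M))"
    and intersections:
      "\<And>k l. k \<in> elems M \<Longrightarrow> l \<in> elems M \<Longrightarrow> k \<noteq> l \<Longrightarrow>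
         element M k \<inter> element M l = {}
         \<or> (\<exists>i<4. \<exists>j<4. corner M k i = corner M l j \<and> element M k \<inter> element M l = {corner M k i})
         \<or> (\<exists>i<4. \<exists>j<4. edge M k i = edge M l j \<and> element M k \<inter> element M l = edge M k i)"
    and strictly_convex: "\<And>k. k \<in> elems M \<Longrightarrow> strictly_convex_quad (corner M k)"
    and boundary_edges:
      "\<And>k i. k \<in> elems M \<Longrightarrow> i < 4 \<Longrightarrow> boundary_edge M k i \<longleftrightarrow> bcurve M k \<noteq> None \<and> i = 2"
    and tangent_nonzero:
      "\<And>k i. k \<in> elems M \<Longrightarrow> bcurve M k \<noteq> None \<Longrightarrow> i \<in> {2, 3} \<Longrightarrow> bd_tangent M k i \<noteq> 0"
    and boundary_G1:
      "\<And>k l i j. k \<in> elems M \<Longrightarrow> l \<in> elems M \<Longrightarrow> k \<noteq> l \<Longrightarrow>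
         bcurve M k \<noteq> None \<Longrightarrow> bcurve M l \<noteq> None \<Longrightarrow> i \<in> {2, 3} \<Longrightarrow> j \<in> {2, 3} \<Longrightarrow>
         corner M k i = corner M l j \<Longrightarrow> \<exists>c>0. bd_tangent M l j = - c *\<^sub>R bd_tangent M k i"
    and boundary_vertex_edges:
      "\<And>p. p \<in> vertices M \<inter> frontier (Omega M) \<Longrightarrow>
         card (edges_at M p) = 3 \<and> card (inner_edges_at M p) = 1"
    and inner_edge_ends:
      "\<And>k i. k \<in> elems M \<Longrightarrow> i < 4 \<Longrightarrow> \<not> boundary_edge M k i \<Longrightarrow>
         corner M k i \<notin> frontier (Omega M) \<or> corner M k (next_corner i) \<notin> frontier (Omega M)"
    and regular_bij: "\<And>k. k \<in> elems M \<Longrightarrow> bij_betw (parametrisation M k) (cbox 0 1) (element M k)"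
    and regular_jacobian:
      "\<And>k w. k \<in> elems M \<Longrightarrow> w \<in> cbox 0 1 \<Longrightarrow> det (jacobian (parametrisation M k) (at w)) \<noteq> 0"

definition C1_on :: "(real^2) set \<Rightarrow> (real^2 \<Rightarrow> real) \<Rightarrow> bool" where
  "C1_on S Z \<longleftrightarrow>
     (\<exists>g. continuous_on S g \<and> (\<forall>x\<in>S. (Z has_derivative (\<lambda>h. g x \<bullet> h)) (at x within S)))"

definition bernstein_form ::
    "'e mesh \<Rightarrow> nat \<Rightarrow> (point \<Rightarrow> real) \<Rightarrow> 'e \<Rightarrow> (nat \<Rightarrow> nat \<Rightarrow> real) \<Rightarrow> bool" where
  "bernstein_form M n Z k c \<longleftrightarrow>
     (\<forall>w\<in>cbox 0 1. Z (parametrisation M k w)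
        = (\<Sum>i\<le>n. \<Sum>j\<le>n. c i j * Bernstein n i (w $ 1) * Bernstein n j (w $ 2)))"

text \<open>A function on \<open>\<Omega>\<close> is represented by its extension by zero.\<close>

definition smooth_space :: "'e mesh \<Rightarrow> nat \<Rightarrow> (point \<Rightarrow> real) set" where
  "smooth_space M n =
     {Z. (\<forall>x. x \<notin> Omega M \<longrightarrow> Z x = 0) \<and> C1_on (Omega M) Z
         \<and> (\<forall>k\<in>elems M. \<exists>c. bernstein_form M n Z k c)}"

definition positions :: "'e mesh \<Rightarrow> nat \<Rightarrow> ('e \<times> nat \<times> nat) set" where
  "positions M n = elems M \<times> {..n} \<times> {..n}"

text \<open>Index of the \<open>m\<close>-th control point along edge \<open>i\<close>, counted from corner \<open>i\<close>.\<close>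

definition edge_index :: "nat \<Rightarrow> nat \<Rightarrow> nat \<Rightarrow> nat \<times> nat" where
  "edge_index n i m = [(m, 0), (n, m), (n - m, n), (0, n - m)] ! i"

text \<open>The two elements at a common edge may traverse it in the same or in opposite directions.\<close>

definition glued :: "'e mesh \<Rightarrow> nat \<Rightarrow> (('e \<times> nat \<times> nat) \<times> ('e \<times> nat \<times> nat)) set" where
  "glued M n =
     {((k, edge_index n i m), (l, edge_index n j m')) | k l i j m m'.
        k \<in> elems M \<and> l \<in> elems M \<and> k \<noteq> l \<and> i < 4 \<and> j < 4 \<and> m \<le> n
        \<and> edge M k i = edge M l j \<and> \<not> boundary_edge M k i
        \<and> (corner M k i = corner M l j \<and> m' = m
           \<or> corner M k i = corner M l (next_corner j) \<and> m' = n - m)}"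

definition same_ctrl :: "'e mesh \<Rightarrow> nat \<Rightarrow> (('e \<times> nat \<times> nat) \<times> ('e \<times> nat \<times> nat)) set" where
  "same_ctrl M n = (glued M n)\<^sup>* \<inter> positions M n \<times> positions M n"

definition ctrl_points :: "'e mesh \<Rightarrow> nat \<Rightarrow> ('e \<times> nat \<times> nat) set set" where
  "ctrl_points M n = positions M n // same_ctrl M n"

definition ctrl_of :: "'e mesh \<Rightarrow> nat \<Rightarrow> 'e \<times> nat \<times> nat \<Rightarrow> ('e \<times> nat \<times> nat) set" where
  "ctrl_of M n x = same_ctrl M n `` {x}"

definition coeff_at :: "'e mesh \<Rightarrow> nat \<Rightarrow> (point \<Rightarrow> real) \<Rightarrow> ('e \<times> nat \<times> nat) set \<Rightarrow> real" where
  "coeff_at M n Z p = (THE z. \<forall>(k, i, j)\<in>p. \<forall>c. bernstein_form M n Z k c \<longrightarrow> c i j = z)"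

definition determining_set :: "'e mesh \<Rightarrow> nat \<Rightarrow> ('e \<times> nat \<times> nat) set set \<Rightarrow> bool" where
  "determining_set M n D \<longleftrightarrow> D \<subseteq> ctrl_points M n \<and>
     (\<forall>Z\<in>smooth_space M n. (\<forall>p\<in>D. coeff_at M n Z p = 0) \<longrightarrow> (\<forall>x\<in>Omega M. Z x = 0))"

definition minimal_determining_set :: "'e mesh \<Rightarrow> nat \<Rightarrow> ('e \<times> nat \<times> nat) set set \<Rightarrow> bool" where
  "minimal_determining_set M n B \<longleftrightarrow>
     determining_set M n B \<and> (\<forall>D. determining_set M n D \<longrightarrow> card B \<le> card D)"

datatype constraint_type =
    Vertex_Interpolation (tangent_planes: bool) (boundary_curve: bool)
  | Simply_Supported
  | Clamped

definition vertex_ctrls :: "'e mesh \<Rightarrow> nat \<Rightarrow> ('e \<times> nat \<times> nat) set set" where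
  "vertex_ctrls M n = {ctrl_of M n (k, edge_index n i 0) | k i. k \<in> elems M \<and> i < 4}"

definition tangent_ctrls :: "'e mesh \<Rightarrow> nat \<Rightarrow> ('e \<times> nat \<times> nat) set set" where
  "tangent_ctrls M n =
     {ctrl_of M n (k, edge_index n i m) | k i m. k \<in> elems M \<and> i < 4 \<and> m \<in> {1, n - 1}}"

definition boundary_ctrls :: "'e mesh \<Rightarrow> nat \<Rightarrow> ('e \<times> nat \<times> nat) set set" where
  "boundary_ctrls M n =
     {ctrl_of M n (k, edge_index n i m) | k i m. k \<in> elems M \<and> i < 4 \<and> boundary_edge M k i \<and> m \<le> n}"

text \<open>The boundary edge of a boundary element is \<open>v = 1\<close>, so the adjacent row is \<open>j = n - 1\<close>.\<close>

definition adjacent_row_ctrls :: "'e mesh \<Rightarrow> nat \<Rightarrow> ('e \<times> nat \<times> nat) set set" where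
  "adjacent_row_ctrls M n =
     {ctrl_of M n (k, i, n - 1) | k i. k \<in> elems M \<and> bcurve M k \<noteq> None \<and> i \<le> n}"

fun fixed_ctrls :: "'e mesh \<Rightarrow> nat \<Rightarrow> constraint_type \<Rightarrow> ('e \<times> nat \<times> nat) set set" where
  "fixed_ctrls M n (Vertex_Interpolation t b) =
     vertex_ctrls M n \<union> (if t then tangent_ctrls M n else {}) \<union> (if b then boundary_ctrls M n else {})"
| "fixed_ctrls M n Simply_Supported = boundary_ctrls M n"
| "fixed_ctrls M n Clamped = boundary_ctrls M n \<union> adjacent_row_ctrls M n"

definition fits ::
    "'e mesh \<Rightarrow> nat \<Rightarrow> ('e \<times> nat \<times> nat) set set \<Rightarrow> ('e \<times> nat \<times> nat) set set \<Rightarrow> bool" where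
  "fits M n B F \<longleftrightarrow>
     (\<forall>p\<in>F. p \<in> B \<or>
        (\<exists>a. \<forall>Z\<in>smooth_space M n. coeff_at M n Z p = (\<Sum>b\<in>B \<inter> F. a b * coeff_at M n Z b)))"

end

theory Submission
  imports Defs "HOL-Library.Function_Algebras"
begin

text \<open>
  Taking the coefficient at a control point is a linear functional on the space of \<open>C\<^sup>1\<close> functions
  \<open>\<F>\<^sup>(\<^sup>n\<^sup>)\<close>, and there are finitely many control points. A set of control points is determining iff
  the common kernel of its functionals is trivial, and for finitely many functionals this means that
  they span the functionals at all control points (\<open>combination_if_common_kernel\<close>). Hence the minimal
  determining sets are the bases of a linear matroid on the control points, and the existence of a
  fitting one is basis extension: choose control points in \<open>F\<close> whose functionals form a basis of
  the span of all functionals at \<open>F\<close>, and extend the choice to a basis for all control points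
  (\<open>fitting_basis\<close>). Every coefficient at \<open>F\<close> is then a combination of those chosen inside \<open>F\<close>,
  whichever type of constraint \<open>F\<close> comes from.

  The mesh enters in two places. First, the coefficient at a control point must not depend on the
  element in which it is read off. Inner edges are straight and every element parametrisation is
  affine along its inner edges (\<open>parametrisation_inner_side\<close>), so the two elements at an inner edge
  give two Bernstein representations of the same univariate polynomial, whose coefficients are unique
  (\<open>coefficients_agree_at_glued\<close>). Second, each element is the image of the unit square, so that a
  function with only zero coefficients vanishes on all of \<open>\<Omega>\<close>
  (\<open>zero_iff_all_coefficients_zero\<close>).
\<close>

section \<open>Finite families of linear functionals\<close>

text \<open>
  This interpretation is used twice: for functions on the plane, and for functionals, which are
  themselves real-valued functions on a space of functions.
\<close>

interpretation fun_space: vector_space "\<lambda>(r::real) (f :: 'a \<Rightarrow> real) x. r * f x"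
  by unfold_locales (auto simp: algebra_simps plus_fun_def)

lemma sum_fun_apply: "(\<Sum>a\<in>A. f a) x = (\<Sum>a\<in>A. f a x)"
  by (induction A rule: infinite_finite_induct) auto

lemma subspace_add_scale:
  assumes "fun_space.subspace V" "Z \<in> V" "W \<in> V"
  shows "(\<lambda>x. Z x + r * W x) \<in> V"
proof -
  have "Z + (\<lambda>x. r * W x) \<in> V"
    by (intro fun_space.subspace_add fun_space.subspace_scale assms)
  then show ?thesis by (simp add: plus_fun_def)
qed

definition linear_functional_on :: "('a \<Rightarrow> real) set \<Rightarrow> (('a \<Rightarrow> real) \<Rightarrow> real) \<Rightarrow> bool" where
  "linear_functional_on V f \<longleftrightarrow>
     (\<forall>Z\<in>V. \<forall>W\<in>V. \<forall>r. f (\<lambda>x. Z x + r * W x) = f Z + r * f W)"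

lemma linear_functional_onD:
  "linear_functional_on V f \<Longrightarrow> Z \<in> V \<Longrightarrow> W \<in> V \<Longrightarrow> f (\<lambda>x. Z x + r * W x) = f Z + r * f W"
  by (simp add: linear_functional_on_def)

text \<open>
  Over a finite-dimensional space this is the double annihilator theorem; here \<open>V\<close> may have any
  dimension. Induction on \<open>D\<close>: on the kernel \<open>K\<close> of one functional \<open>L d\<close> the others suffice, and as
  \<open>K\<close> has codimension at most one, the error that remains on \<open>V\<close> is a multiple of \<open>L d\<close>.
\<close>

lemma combination_if_common_kernel:
  fixes L :: "'p \<Rightarrow> ('a \<Rightarrow> real) \<Rightarrow> real"
  assumes "finite D" and "fun_space.subspace V"
    and "\<And>p. p \<in> D \<Longrightarrow> linear_functional_on V (L p)" and "linear_functional_on V g"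
    and "\<And>Z. Z \<in> V \<Longrightarrow> (\<And>p. p \<in> D \<Longrightarrow> L p Z = 0) \<Longrightarrow> g Z = 0"
  shows "\<exists>a. \<forall>Z\<in>V. g Z = (\<Sum>p\<in>D. a p * L p Z)"
  using assms
proof (induction D arbitrary: V rule: finite_induct)
  case empty
  then show ?case by simp
next
  case (insert d D)
  note V = insert.prems(1)
  have Ld: "linear_functional_on V (L d)" using insert.prems(2) by simp
  define K where "K = {Z \<in> V. L d Z = 0}"
  have zero: "L d 0 = 0"
    using linear_functional_onD[OF Ld, of 0 0 "-1"] fun_space.subspace_0[OF V]
    by (simp add: zero_fun_def)
  have K: "fun_space.subspace K"
    unfolding fun_space.subspace_def
  proof (intro conjI ballI allI)
    show "0 \<in> K" using zero fun_space.subspace_0[OF V] by (simp add: K_def)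
  next
    fix Z W assume "Z \<in> K" "W \<in> K"
    then show "Z + W \<in> K"
      using linear_functional_onD[OF Ld, of Z W 1] fun_space.subspace_add[OF V, of Z W]
      by (simp add: K_def plus_fun_def)
  next
    fix c Z assume "Z \<in> K"
    then show "(\<lambda>x. c * Z x) \<in> K"
      using linear_functional_onD[OF Ld, of 0 Z c] fun_space.subspace_scale[OF V, of Z c]
        fun_space.subspace_0[OF V] zero
      by (simp add: K_def)
  qed
  have KV: "linear_functional_on V f \<Longrightarrow> linear_functional_on K f" for f
    unfolding linear_functional_on_def K_def by blast
  have gD: "\<And>Z. Z \<in> K \<Longrightarrow> (\<And>p. p \<in> D \<Longrightarrow> L p Z = 0) \<Longrightarrow> g Z = 0"
    by (rule insert.prems(4)) (auto simp: K_def)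
  have "\<exists>a. \<forall>Z\<in>K. g Z = (\<Sum>p\<in>D. a p * L p Z)"
    by (rule insert.IH[OF K]) (use KV gD insert.prems(2,3) in blast)+
  then obtain a where a: "\<And>Z. Z \<in> K \<Longrightarrow> g Z = (\<Sum>p\<in>D. a p * L p Z)"
    by blast
  show ?case
  proof (cases "\<exists>Y\<in>V. L d Y \<noteq> 0")
    case False
    then have "K = V" by (auto simp: K_def)
    then have "\<forall>Z\<in>V. g Z = (\<Sum>p\<in>insert d D. a p * L p Z)"
      using a False insert.hyps by simp
    then show ?thesis by blast
  next
    case True
    then obtain Y where Y: "Y \<in> V" "L d Y \<noteq> 0" by blast
    define b where "b = a(d := (g Y - (\<Sum>p\<in>D. a p * L p Y)) / L d Y)"
    have "g Z = (\<Sum>p\<in>insert d D. b p * L p Z)" if Z: "Z \<in> V" for Z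
    proof -
      define s where "s = L d Z / L d Y"
      \<comment> \<open>Subtracting the right multiple of \<open>Y\<close> moves \<open>Z\<close> into the kernel of \<open>L d\<close>.\<close>
      define X where "X = (\<lambda>x. Z x + (- s) * Y x)"
      have lin: "f X = f Z - s * f Y" if "linear_functional_on V f" for f
        using linear_functional_onD[OF that Z Y(1), of "- s"] by (simp add: X_def)
      have "X \<in> V" unfolding X_def by (rule subspace_add_scale[OF V Z Y(1)])
      then have "X \<in> K" using lin[OF Ld] Y(2) by (simp add: K_def s_def)
      then have "g Z - s * g Y = (\<Sum>p\<in>D. a p * L p X)"
        using a lin[OF insert.prems(3)] by simp
      also have "\<dots> = (\<Sum>p\<in>D. a p * L p Z - s * (a p * L p Y))"
        by (intro sum.cong refl) (simp add: lin[OF insert.prems(2)] right_diff_distrib mult_ac)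
      also have "\<dots> = (\<Sum>p\<in>D. a p * L p Z) - s * (\<Sum>p\<in>D. a p * L p Y)"
        by (simp add: sum_subtractf sum_distrib_left)
      finally have "g Z = (\<Sum>p\<in>D. a p * L p Z) + s * (g Y - (\<Sum>p\<in>D. a p * L p Y))"
        by (simp add: algebra_simps)
      also have "(\<Sum>p\<in>D. a p * L p Z) = (\<Sum>p\<in>D. b p * L p Z)"
        using insert.hyps(2) by (intro sum.cong) (auto simp: b_def)
      also have "s * (g Y - (\<Sum>p\<in>D. a p * L p Y)) = b d * L d Z"
        by (simp add: b_def s_def)
      finally show ?thesis using insert.hyps by simp
    qed
    then show ?thesis by blast
  qed
qed

lemma span_image_combination:
  fixes f :: "'p \<Rightarrow> 'a \<Rightarrow> real"
  assumes "finite I" "inj_on f I" "g \<in> fun_space.span (f ` I)"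
  shows "\<exists>a. \<forall>x. g x = (\<Sum>b\<in>I. a b * f b x)"
proof -
  obtain u where "g = (\<Sum>v\<in>f ` I. (\<lambda>x. u v * v x))"
    using assms fun_space.span_finite[of "f ` I"] by auto
  then have "g x = (\<Sum>b\<in>I. u (f b) * f b x)" for x
    using assms(2) by (simp add: sum_fun_apply sum.reindex)
  then show ?thesis by (intro exI[of _ "u \<circ> f"]) simp
qed

text \<open>
  Basis extension from \<open>F\<close> to \<open>P\<close>. The statement speaks of labels \<open>p\<close> instead of functionals \<open>L p\<close>,
  since distinct labels may carry the same functional; one label is chosen for each basis
  functional, and for the functionals of the basis of \<open>F\<close> that label is taken from \<open>F\<close>. A set of
  labels with trivial common kernel spans all functionals and therefore cannot be smaller than the
  independent set \<open>B\<close>.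
\<close>

lemma fitting_basis:
  fixes L :: "'p \<Rightarrow> ('a \<Rightarrow> real) \<Rightarrow> real"
  assumes P: "finite P" and F: "F \<subseteq> P" and V: "fun_space.subspace V"
    and L: "\<forall>p\<in>P. linear_functional_on V (L p)"
  shows "\<exists>B. B \<subseteq> P
    \<and> (\<forall>p\<in>P. \<exists>a. \<forall>Z\<in>V. L p Z = (\<Sum>b\<in>B. a b * L b Z))
    \<and> (\<forall>p\<in>F. \<exists>a. \<forall>Z\<in>V. L p Z = (\<Sum>b\<in>B \<inter> F. a b * L b Z))
    \<and> (\<forall>D\<subseteq>P. (\<forall>Z\<in>V. (\<forall>d\<in>D. L d Z = 0) \<longrightarrow> (\<forall>p\<in>P. L p Z = 0)) \<longrightarrow> card B \<le> card D)"
proof -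
  \<comment> \<open>Cutting the functionals off outside \<open>V\<close> turns relations that hold on \<open>V\<close> into
    linear relations between vectors.\<close>
  define f where "f p Z = (if Z \<in> V then L p Z else 0)" for p Z
  obtain I' where I': "I' \<subseteq> f ` F" "fun_space.independent I'" "f ` F \<subseteq> fun_space.span I'"
    by (rule fun_space.maximal_independent_subset)
  have "I' \<subseteq> f ` P" using I'(1) F by blast
  then obtain B' where B': "I' \<subseteq> B'" "B' \<subseteq> f ` P" "fun_space.independent B'"
      "f ` P \<subseteq> fun_space.span B'"
    using fun_space.maximal_independent_subset_extend I'(2) by metis
  obtain I where I: "I \<subseteq> F" "inj_on f I" "I' = f ` I"
    using subset_image_inj[of I' f F] I'(1) by blast
  have "B' - I' \<subseteq> f ` P" using B'(2) by blast
  then obtain J where J: "J \<subseteq> P" "inj_on f J" "B' - I' = f ` J"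
    using subset_image_inj[of "B' - I'" f P] by blast
  define B where "B = I \<union> J"
  have BP: "B \<subseteq> P" using I(1) J(1) F by (auto simp: B_def)
  have fB: "f ` B = B'" using I(3) J(3) B'(1) by (auto simp: B_def image_Un)
  have "f ` I \<inter> f ` J = {}" using I(3) J(3) by blast
  then have inj: "inj_on f B"
    unfolding B_def using I(2) J(2) by (subst inj_on_Un) blast
  have fin: "finite B" using BP P by (rule finite_subset)
  show ?thesis
  proof (intro exI[of _ B] conjI ballI allI impI)
    show "B \<subseteq> P" by (rule BP)
  next
    fix p assume "p \<in> P"
    then have "f p \<in> fun_space.span (f ` B)" using B'(4) fB by auto
    then obtain a where a: "\<And>Z. f p Z = (\<Sum>b\<in>B. a b * f b Z)"
      using span_image_combination[OF fin inj, of "f p"] by blast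
    have "L p Z = (\<Sum>b\<in>B. a b * L b Z)" if "Z \<in> V" for Z
      using a[of Z] that by (simp add: f_def)
    then show "\<exists>a. \<forall>Z\<in>V. L p Z = (\<Sum>b\<in>B. a b * L b Z)" by blast
  next
    fix p assume "p \<in> F"
    moreover have "f ` I \<subseteq> f ` (B \<inter> F)" using I(1) by (auto simp: B_def)
    ultimately have "f p \<in> fun_space.span (f ` (B \<inter> F))"
      using I'(3) I(3) fun_space.span_mono[of "f ` I" "f ` (B \<inter> F)"] by blast
    moreover have "finite (B \<inter> F)" using fin by simp
    moreover have "inj_on f (B \<inter> F)" using inj by (rule inj_on_subset) simp
    ultimately obtain a where a: "\<And>Z. f p Z = (\<Sum>b\<in>B \<inter> F. a b * f b Z)"
      using span_image_combination[of "B \<inter> F" f "f p"] by blast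
    have "L p Z = (\<Sum>b\<in>B \<inter> F. a b * L b Z)" if "Z \<in> V" for Z
      using a[of Z] that by (simp add: f_def)
    then show "\<exists>a. \<forall>Z\<in>V. L p Z = (\<Sum>b\<in>B \<inter> F. a b * L b Z)" by blast
  next
    fix D
    assume D: "D \<subseteq> P"
      and det: "\<forall>Z\<in>V. (\<forall>d\<in>D. L d Z = 0) \<longrightarrow> (\<forall>p\<in>P. L p Z = 0)"
    have finD: "finite D" using D P by (rule finite_subset)
    have "f p \<in> fun_space.span (f ` D)" if p: "p \<in> P" for p
    proof -
      have LD: "\<And>d. d \<in> D \<Longrightarrow> linear_functional_on V (L d)" using L D by blast
      have "\<exists>a. \<forall>Z\<in>V. L p Z = (\<Sum>d\<in>D. a d * L d Z)"
        by (rule combination_if_common_kernel[OF finD V LD bspec[OF L p]]) (use det p in blast)+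
      then obtain a where "\<And>Z. Z \<in> V \<Longrightarrow> L p Z = (\<Sum>d\<in>D. a d * L d Z)" by blast
      then have "f p = (\<Sum>d\<in>D. (\<lambda>Z. a d * f d Z))"
        by (intro ext) (simp add: f_def sum_fun_apply)
      also have "\<dots> \<in> fun_space.span (f ` D)"
        by (intro fun_space.span_sum fun_space.span_scale fun_space.span_base imageI)
      finally show ?thesis .
    qed
    then have "B' \<subseteq> fun_space.span (f ` D)" using B'(2) by blast
    then have "card B' \<le> card (f ` D)"
      using fun_space.independent_span_bound[OF finite_imageI[OF finD] B'(3)] by blast
    also have "\<dots> \<le> card D" by (rule card_image_le[OF finD])
    finally show "card B \<le> card D" using card_image[OF inj] fB by simp
  qed
qed


section \<open>Uniqueness of Bernstein coefficients\<close>

lemma Bernstein_combination_zero: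
  fixes a :: "nat \<Rightarrow> real"
  assumes "\<And>t. 0 \<le> t \<Longrightarrow> t \<le> 1 \<Longrightarrow> (\<Sum>m\<le>n. a m * Bernstein n m t) = 0" and "m \<le> n"
  shows "a m = 0"
proof (rule ccontr)
  assume "a m \<noteq> 0"
  then have "finite {s::real. (\<Sum>m\<le>n. (a m * (n choose m)) * s ^ m) = 0}" (is "finite ?R")
    using assms(2) by (subst polyfun_finite_roots) auto
  moreover have "{0<..} \<subseteq> ?R"
  proof
    fix s :: real assume "s \<in> {0<..}"
    then have s: "s > 0" by simp
    \<comment> \<open>The substitution \<open>t = s / (1 + s)\<close> turns Bernstein polynomials, up to a common factor,
      into monomials.\<close>
    have "a m * (n choose m) * s ^ m = (1 + s) ^ n * (a m * Bernstein n m (s / (1 + s)))"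
      if "m \<le> n" for m
    proof -
      have "1 - s / (1 + s) = 1 / (1 + s)" using s by (simp add: field_simps)
      moreover have "(1 + s) ^ n = (1 + s) ^ m * (1 + s) ^ (n - m)"
        using that by (simp flip: power_add)
      ultimately show ?thesis using s by (simp add: Bernstein_def power_divide)
    qed
    then have "(\<Sum>m\<le>n. a m * (n choose m) * s ^ m)
        = (1 + s) ^ n * (\<Sum>m\<le>n. a m * Bernstein n m (s / (1 + s)))"
      unfolding sum_distrib_left by (intro sum.cong refl) blast
    also have "\<dots> = 0" using s by (subst assms(1)) auto
    finally show "s \<in> ?R" by simp
  qed
  ultimately show False using infinite_Ioi[of "0::real"] finite_subset by blast
qed

lemma Bernstein_coefficients_unique:
  fixes a b :: "nat \<Rightarrow> real"
  assumes "\<And>t. 0 \<le> t \<Longrightarrow> t \<le> 1 \<Longrightarrow>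
      (\<Sum>m\<le>n. a m * Bernstein n m t) = (\<Sum>m\<le>n. b m * Bernstein n m t)" and "m \<le> n"
  shows "a m = b m"
  using Bernstein_combination_zero[where n = n and a = "\<lambda>m. a m - b m" and m = m] assms
  by (simp add: left_diff_distrib sum_subtractf)

text \<open>
  Tensor product coefficients are recovered one variable at a time. Uniqueness holds only for
  indices up to \<open>n\<close>, as a Bernstein form does not constrain the values of \<open>c\<close> elsewhere.
\<close>

lemma bernstein_form_unique:
  assumes "bernstein_form M n Z k c" "bernstein_form M n Z k d" "i \<le> n" "j \<le> n"
  shows "c i j = d i j"
proof -
  have "(\<Sum>j\<le>n. c i j * Bernstein n j v) = (\<Sum>j\<le>n. d i j * Bernstein n j v)"
    if v: "0 \<le> v" "v \<le> 1" for v
  proof (rule Bernstein_coefficients_unique[OF _ \<open>i \<le> n\<close>])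
    fix u :: real assume u: "0 \<le> u" "u \<le> 1"
    have "vector [u, v] \<in> cbox 0 (1 :: real^2)"
      using u v by (simp add: mem_box_cart forall_2)
    then have "(\<Sum>i\<le>n. \<Sum>j\<le>n. c i j * Bernstein n i u * Bernstein n j v)
        = (\<Sum>i\<le>n. \<Sum>j\<le>n. d i j * Bernstein n i u * Bernstein n j v)"
      using assms(1,2) unfolding bernstein_form_def by (force simp: vector_2)
    then show "(\<Sum>i\<le>n. (\<Sum>j\<le>n. c i j * Bernstein n j v) * Bernstein n i u)
        = (\<Sum>i\<le>n. (\<Sum>j\<le>n. d i j * Bernstein n j v) * Bernstein n i u)"
      by (simp add: sum_distrib_left sum_distrib_right mult_ac)
  qed
  then show ?thesis by (rule Bernstein_coefficients_unique[OF _ \<open>j \<le> n\<close>])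
qed


section \<open>Coefficients along common edges\<close>

text \<open>
  The side of the unit square that a parametrisation maps to edge \<open>i\<close> of its element, traversed from
  corner \<open>i\<close> to corner \<open>i + 1\<close>. This matches the direction in which \<^const>\<open>edge_index\<close> counts.
\<close>

definition square_side :: "nat \<Rightarrow> real \<Rightarrow> real^2" where
  "square_side i t = [vector [t, 0], vector [1, t], vector [1 - t, 1], vector [0, 1 - t]] ! i"

lemma square_side_values:
  "square_side 0 t = vector [t, 0]" "square_side 1 t = vector [1, t]"
  "square_side 2 t = vector [1 - t, 1]" "square_side 3 t = vector [0, 1 - t]"
  by (simp_all add: square_side_def)

lemma next_corner_values:
  "next_corner 0 = 1" "next_corner 1 = 2" "next_corner 2 = 3" "next_corner 3 = 0"
  by (simp_all add: next_corner_def)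

lemma less_4_cases: "(i::nat) < 4 \<Longrightarrow> i = 0 \<or> i = 1 \<or> i = 2 \<or> i = 3"
  by auto

lemma square_side_in_square:
  assumes "i < 4" "0 \<le> t" "t \<le> 1"
  shows "square_side i t \<in> cbox 0 1"
  using less_4_cases[OF assms(1)] assms(2,3)
  by (auto simp: square_side_def mem_box_cart forall_2 eval_nat_numeral)

lemma Bernstein_at_0: "Bernstein n i 0 = (if i = 0 then 1 else 0)"
  by (simp add: Bernstein_def)

lemma Bernstein_at_1: "i \<le> n \<Longrightarrow> Bernstein n i 1 = (if i = n then 1 else 0)"
  by (simp add: Bernstein_def)

lemma Bernstein_flip: "m \<le> n \<Longrightarrow> Bernstein n (n - m) (1 - t) = Bernstein n m t"
  by (simp add: Bernstein_def flip: binomial_symmetric)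

lemma sum_Bernstein_flip:
  "(\<Sum>m\<le>n. h m * Bernstein n m (1 - t)) = (\<Sum>m\<le>n. h (n - m) * Bernstein n m t)"
proof -
  have "(\<Sum>m\<le>n. h m * Bernstein n m (1 - t))
      = (\<Sum>m\<le>n. h (n - m) * Bernstein n (n - m) (1 - t))"
    by (rule sum.reindex_bij_witness[of _ "\<lambda>m. n - m" "\<lambda>m. n - m"]) auto
  then show ?thesis by (simp add: Bernstein_flip)
qed

lemma Bernstein_linear_precision:
  fixes P Q :: "'a::real_vector"
  assumes "n > 0"
  shows "(\<Sum>m\<le>n. Bernstein n m t *\<^sub>R ((1 - m / n) *\<^sub>R P + (m / n) *\<^sub>R Q))
    = (1 - t) *\<^sub>R P + t *\<^sub>R Q"
proof -
  have frac: "(\<Sum>m\<le>n. Bernstein n m t * (m / n)) = t"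
    using sum_k_Bernstein[of n t] assms by (simp add: mult_ac flip: sum_divide_distrib)
  then have "(\<Sum>m\<le>n. Bernstein n m t * (1 - m / n)) = 1 - t"
    by (simp add: right_diff_distrib sum_subtractf)
  with frac show ?thesis
    by (simp add: scaleR_add_right sum.distrib flip: scaleR_left.sum)
qed

text \<open>
  The rows and columns of the bicubic net along inner edges are degree elevations of linear ones, so
  that a boundary element, too, is parametrised affinely along its inner edges. This makes the
  parametrisations of two neighbours compatible along their common edge.
\<close>

lemma parametrisation_inner_side:
  assumes "i < 4" "bcurve M k = None \<or> i \<noteq> 2"
  shows "parametrisation M k (square_side i t)
    = (1 - t) *\<^sub>R corner M k i + t *\<^sub>R corner M k (next_corner i)"
proof (cases "bcurve M k")
  case None
  then show ?thesis using less_4_cases[OF assms(1)]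
    by (elim disjE)
      (simp_all only: square_side_values next_corner_values,
        simp_all add: parametrisation_def bilinear_map_def)
next
  case (Some EF)
  obtain E F where EF: "EF = (E, F)" by (cases EF)
  let ?A = "corner M k 0" and ?B = "corner M k 1" and ?C = "corner M k 2" and ?D = "corner M k 3"
  have pick0: "(\<Sum>j\<le>3. Bernstein 3 j 0 *\<^sub>R g j) = g 0" for g :: "nat \<Rightarrow> point"
    by (simp add: Bernstein_at_0 eval_nat_numeral)
  have pick1: "(\<Sum>j\<le>3. Bernstein 3 j 1 *\<^sub>R g j) = g 3" for g :: "nat \<Rightarrow> point"
    by (simp add: Bernstein_def eval_nat_numeral)
  have inner: "(\<Sum>i\<le>3. \<Sum>j\<le>3. (Bernstein 3 i u * Bernstein 3 j v) *\<^sub>R bicubic_net M k i j)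
      = (\<Sum>i\<le>3. Bernstein 3 i u *\<^sub>R (\<Sum>j\<le>3. Bernstein 3 j v *\<^sub>R bicubic_net M k i j))" for u v
    by (simp add: scaleR_sum_right)
  have bottom: "bicubic_net M k m 0 = (1 - m / real 3) *\<^sub>R ?A + (m / real 3) *\<^sub>R ?B" for m
    using Some EF by (simp add: bicubic_net_def bilinear_map_def Let_def)
  have right: "bicubic_net M k 3 m = (1 - m / real 3) *\<^sub>R ?B + (m / real 3) *\<^sub>R ?C" for m
    using Some EF by (simp add: bicubic_net_def bilinear_map_def Let_def)
  have left: "bicubic_net M k 0 m = (1 - m / real 3) *\<^sub>R ?A + (m / real 3) *\<^sub>R ?D" for m
    using Some EF by (simp add: bicubic_net_def bilinear_map_def Let_def)
  have lin: "(\<Sum>m\<le>3. Bernstein 3 m t *\<^sub>R ((1 - m / real 3) *\<^sub>R P + (m / real 3) *\<^sub>R Q))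
      = (1 - t) *\<^sub>R P + t *\<^sub>R Q" for t and P Q :: point
    using Bernstein_linear_precision[of 3 t P Q] by simp
  have param: "parametrisation M k (vector [u, v])
      = (\<Sum>i\<le>3. Bernstein 3 i u *\<^sub>R (\<Sum>j\<le>3. Bernstein 3 j v *\<^sub>R bicubic_net M k i j))" for u v
    using Some inner by (simp add: parametrisation_def)
  consider "i = 0" | "i = 1" | "i = 3" using less_4_cases[OF assms(1)] assms(2) Some by auto
  then show ?thesis
  proof cases
    case 1
    then show ?thesis
      by (simp only: square_side_values next_corner_values param pick0 bottom lin)
  next
    case 2
    then show ?thesis
      by (simp only: square_side_values next_corner_values param pick1 right lin)
  next
    case 3
    then show ?thesis
      by (simp only: square_side_values next_corner_values param pick0 left lin) simp
  qed
qed

lemma form_on_side: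
  assumes "i < 4"
  shows "(\<Sum>p\<le>n. \<Sum>q\<le>n. c p q * Bernstein n p (square_side i t $ 1) * Bernstein n q (square_side i t $ 2))
    = (\<Sum>m\<le>n. case_prod c (edge_index n i m) * Bernstein n m t)"
proof -
  have col0: "(\<Sum>q\<le>n. g q * Bernstein n q 0) = g 0" for g :: "nat \<Rightarrow> real"
    by (simp add: Bernstein_at_0 if_distrib sum.delta cong: if_cong)
  have col1: "(\<Sum>q\<le>n. g q * Bernstein n q 1) = g n" for g :: "nat \<Rightarrow> real"
  proof -
    have "(\<Sum>q\<le>n. g q * Bernstein n q 1) = (\<Sum>q\<le>n. if q = n then g n else 0)"
      by (rule sum.cong) (auto simp: Bernstein_at_1)
    then show ?thesis by simp
  qed
  have swap: "(\<Sum>p\<le>n. \<Sum>q\<le>n. c p q * Bernstein n p u * Bernstein n q v)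
      = (\<Sum>q\<le>n. (\<Sum>p\<le>n. c p q * Bernstein n p u) * Bernstein n q v)" for u v
    by (subst sum.swap) (simp add: sum_distrib_right)
  consider "i = 0" | "i = 1" | "i = 2" | "i = 3" using less_4_cases[OF assms] by blast
  then show ?thesis
  proof cases
    case 1
    then show ?thesis by (simp add: square_side_def edge_index_def col0)
  next
    case 2
    then show ?thesis by (simp add: swap square_side_def edge_index_def col1)
  next
    case 3
    then show ?thesis by (simp add: square_side_def edge_index_def col1 sum_Bernstein_flip)
  next
    case 4
    then show ?thesis
      by (simp add: swap square_side_def edge_index_def col0, intro sum_Bernstein_flip)
  qed
qed

lemma edge_index_le: "i < 4 \<Longrightarrow> m \<le> n \<Longrightarrow> edge_index n i m \<in> {..n} \<times> {..n}"
  using less_4_cases[of i] by (auto simp: edge_index_def)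

text \<open>
  Both coefficient rows represent \<open>Z\<close> restricted to the common segment, in the same affine parameter
  up to reversal; reversal of the parameter reverses the Bernstein basis. That the segments agree as
  sets forces the second endpoints to match once the first ones do.
\<close>

lemma coefficients_agree_at_glued:
  assumes M: "quad_mesh M" and "(x, y) \<in> glued M n"
    and "bernstein_form M n Z (fst x) c" "bernstein_form M n Z (fst y) d"
  shows "case_prod c (snd x) = case_prod d (snd y)"
proof -
  interpret quad_mesh M by (rule M)
  obtain k l i j m m' where x: "x = (k, edge_index n i m)" and y: "y = (l, edge_index n j m')"
    and kl: "k \<in> elems M" "l \<in> elems M" and ij: "i < 4" "j < 4" and m: "m \<le> n"
    and e: "edge M k i = edge M l j" and inner: "\<not> boundary_edge M k i"
    and orient: "corner M k i = corner M l j \<and> m' = m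
      \<or> corner M k i = corner M l (next_corner j) \<and> m' = n - m"
    using assms(2) unfolding glued_def by blast
  have ib: "bcurve M k = None \<or> i \<noteq> 2" using boundary_edges[OF kl(1) ij(1)] inner by auto
  have "\<not> boundary_edge M l j" using inner e by (simp add: boundary_edge_def)
  then have jb: "bcurve M l = None \<or> j \<noteq> 2" using boundary_edges[OF kl(2) ij(2)] by auto
  let ?P = "corner M k i" and ?Q = "corner M k (next_corner i)"
  let ?R = "corner M l j" and ?S = "corner M l (next_corner j)"
  have "closed_segment ?P ?Q = closed_segment ?R ?S" using e ib jb by (auto simp: edge_def)
  then have ends: "{?P, ?Q} = {?R, ?S}" by (simp add: closed_segment_eq)
  have onk: "Z ((1 - t) *\<^sub>R ?P + t *\<^sub>R ?Q)
      = (\<Sum>m\<le>n. case_prod c (edge_index n i m) * Bernstein n m t)" if t: "0 \<le> t" "t \<le> 1" for t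
    using assms(3) square_side_in_square[OF ij(1) t] form_on_side[OF ij(1), of c n t]
      parametrisation_inner_side[OF ij(1) ib, of t] x
    unfolding bernstein_form_def by force
  have onl: "Z ((1 - t) *\<^sub>R ?R + t *\<^sub>R ?S)
      = (\<Sum>m\<le>n. case_prod d (edge_index n j m) * Bernstein n m t)" if t: "0 \<le> t" "t \<le> 1" for t
    using assms(4) square_side_in_square[OF ij(2) t] form_on_side[OF ij(2), of d n t]
      parametrisation_inner_side[OF ij(2) jb, of t] y
    unfolding bernstein_form_def by force
  from orient show ?thesis
  proof
    assume o: "?P = ?R \<and> m' = m"
    then have Q: "?Q = ?S" using ends by (auto simp: doubleton_eq_iff)
    have "case_prod c (edge_index n i m) = case_prod d (edge_index n j m)"
    proof (rule Bernstein_coefficients_unique[OF _ m])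
      fix t :: real assume t: "0 \<le> t" "t \<le> 1"
      show "(\<Sum>m\<le>n. case_prod c (edge_index n i m) * Bernstein n m t)
          = (\<Sum>m\<le>n. case_prod d (edge_index n j m) * Bernstein n m t)"
        using onk[OF t] onl[OF t] o Q by simp
    qed
    then show ?thesis using o x y by simp
  next
    assume o: "?P = ?S \<and> m' = n - m"
    then have Q: "?Q = ?R" using ends by (auto simp: doubleton_eq_iff)
    have "case_prod c (edge_index n i m) = case_prod d (edge_index n j (n - m))"
    proof (rule Bernstein_coefficients_unique[OF _ m])
      fix t :: real assume t: "0 \<le> t" "t \<le> 1"
      have "(\<Sum>m\<le>n. case_prod c (edge_index n i m) * Bernstein n m t)
          = Z ((1 - (1 - t)) *\<^sub>R ?R + (1 - t) *\<^sub>R ?S)"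
        using onk[OF t] o Q by (simp add: add.commute)
      also have "\<dots> = (\<Sum>m\<le>n. case_prod d (edge_index n j m) * Bernstein n m (1 - t))"
        using t by (intro onl) auto
      also have "\<dots> = (\<Sum>m\<le>n. case_prod d (edge_index n j (n - m)) * Bernstein n m t)"
        by (rule sum_Bernstein_flip)
      finally show "(\<Sum>m\<le>n. case_prod c (edge_index n i m) * Bernstein n m t)
          = (\<Sum>m\<le>n. case_prod d (edge_index n j (n - m)) * Bernstein n m t)" .
    qed
    then show ?thesis using o x y by simp
  qed
qed

lemma coefficients_agree_at_same_ctrl:
  assumes M: "quad_mesh M" and Z: "Z \<in> smooth_space M n" and "(x, y) \<in> (glued M n)\<^sup>*"
    and "x \<in> positions M n"
    and "bernstein_form M n Z (fst x) c" and "bernstein_form M n Z (fst y) d"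
  shows "case_prod c (snd x) = case_prod d (snd y)"
proof -
  have "y \<in> positions M n \<and>
      (\<forall>d. bernstein_form M n Z (fst y) d \<longrightarrow> case_prod c (snd x) = case_prod d (snd y))"
    using assms(3)
  proof (induction rule: rtrancl_induct)
    case base
    have "fst (snd x) \<le> n" "snd (snd x) \<le> n" using assms(4) by (auto simp: positions_def)
    then show ?case
      using assms(4) bernstein_form_unique[OF assms(5)] unfolding split_beta by blast
  next
    case (step y z)
    obtain l j m' where "z = (l, edge_index n j m')" "l \<in> elems M" "j < 4" "m' \<le> n"
      using step.hyps(2) unfolding glued_def by fastforce
    then have z: "z \<in> positions M n"
      using edge_index_le[of j m' n] by (simp add: positions_def)
    have "fst y \<in> elems M" using step.IH by (auto simp: positions_def)
    then obtain e where "bernstein_form M n Z (fst y) e" using Z by (auto simp: smooth_space_def)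
    then show ?case
      using z step.IH coefficients_agree_at_glued[OF M step.hyps(2)] by (auto; metis)
  qed
  then show ?thesis using assms(6) by blast
qed

text \<open>
  The definite description in \<^const>\<open>coeff_at\<close> denotes something only because all positions of a
  control point carry the same coefficient. From here on coefficients can be computed in any one of
  these positions.
\<close>

lemma coeff_at_ctrl_of:
  assumes "quad_mesh M" "Z \<in> smooth_space M n" "(k, i, j) \<in> positions M n"
    and "bernstein_form M n Z k c"
  shows "coeff_at M n Z (ctrl_of M n (k, i, j)) = c i j"
proof -
  have self: "(k, i, j) \<in> ctrl_of M n (k, i, j)"
    using assms(3) by (simp add: ctrl_of_def same_ctrl_def)
  have agree: "d i' j' = c i j"
    if "(l, i', j') \<in> ctrl_of M n (k, i, j)" "bernstein_form M n Z l d" for l i' j' d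
    using coefficients_agree_at_same_ctrl[OF assms(1,2) _ assms(3), of "(l, i', j')" c d] assms(4) that
    by (auto simp: ctrl_of_def same_ctrl_def)
  show ?thesis
    unfolding coeff_at_def
  proof (rule the_equality)
    show "\<forall>(l, i', j')\<in>ctrl_of M n (k, i, j). \<forall>d. bernstein_form M n Z l d \<longrightarrow> d i' j' = c i j"
      using agree by blast
  next
    fix z assume "\<forall>(l, i', j')\<in>ctrl_of M n (k, i, j). \<forall>d. bernstein_form M n Z l d \<longrightarrow> d i' j' = z"
    then show "z = c i j" using self assms(4) by fastforce
  qed
qed


section \<open>Coefficients as linear functionals on the spline space\<close>

lemma C1_on_add_scale:
  assumes "C1_on S Z" "C1_on S W"
  shows "C1_on S (\<lambda>x. Z x + r * W x)"
proof -
  obtain g h where g: "continuous_on S g" "\<And>x. x \<in> S \<Longrightarrow> (Z has_derivative (\<lambda>y. g x \<bullet> y)) (at x within S)"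
    and h: "continuous_on S h" "\<And>x. x \<in> S \<Longrightarrow> (W has_derivative (\<lambda>y. h x \<bullet> y)) (at x within S)"
    using assms unfolding C1_on_def by blast
  have "continuous_on S (\<lambda>x. g x + r *\<^sub>R h x)"
    using g(1) h(1) by (intro continuous_intros)
  moreover have "((\<lambda>x. Z x + r * W x) has_derivative (\<lambda>y. (g x + r *\<^sub>R h x) \<bullet> y)) (at x within S)"
    if "x \<in> S" for x
    using g(2)[OF that] h(2)[OF that]
    by (auto intro!: derivative_eq_intros simp: inner_add_left)
  ultimately show ?thesis unfolding C1_on_def by blast
qed

lemma bernstein_form_add_scale:
  assumes "bernstein_form M n Z k c" "bernstein_form M n W k d"
  shows "bernstein_form M n (\<lambda>x. Z x + r * W x) k (\<lambda>i j. c i j + r * d i j)"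
  using assms unfolding bernstein_form_def
  by (simp add: sum.distrib sum_distrib_left algebra_simps)

lemma smooth_space_add_scale:
  assumes "Z \<in> smooth_space M n" "W \<in> smooth_space M n"
  shows "(\<lambda>x. Z x + r * W x) \<in> smooth_space M n"
proof -
  have "\<exists>c. bernstein_form M n (\<lambda>x. Z x + r * W x) k c" if k: "k \<in> elems M" for k
  proof -
    obtain c d where "bernstein_form M n Z k c" "bernstein_form M n W k d"
      using assms k unfolding smooth_space_def by blast
    then show ?thesis by (intro exI) (rule bernstein_form_add_scale)
  qed
  moreover have "C1_on (Omega M) (\<lambda>x. Z x + r * W x)"
    using assms by (intro C1_on_add_scale) (auto simp: smooth_space_def)
  ultimately show ?thesis using assms by (simp add: smooth_space_def)
qed

lemma zero_in_smooth_space: "0 \<in> smooth_space M n"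
proof -
  have "C1_on (Omega M) 0"
    unfolding C1_on_def zero_fun_def
    by (intro exI[of _ "\<lambda>_. 0"]) (auto intro!: derivative_eq_intros)
  moreover have "bernstein_form M n 0 k (\<lambda>_ _. 0)" for k
    by (simp add: bernstein_form_def)
  ultimately show ?thesis unfolding smooth_space_def by auto
qed

lemma subspace_smooth_space: "fun_space.subspace (smooth_space M n)"
  unfolding fun_space.subspace_def
proof (intro conjI ballI allI)
  fix Z W assume "Z \<in> smooth_space M n" "W \<in> smooth_space M n"
  then show "Z + W \<in> smooth_space M n"
    using smooth_space_add_scale[of Z M n W 1] by (simp add: plus_fun_def)
next
  fix c Z assume "Z \<in> smooth_space M n"
  then show "(\<lambda>x. c * Z x) \<in> smooth_space M n"
    using smooth_space_add_scale[OF zero_in_smooth_space, of Z M n c] by simp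
qed (rule zero_in_smooth_space)

lemma ctrl_points_cases:
  assumes "p \<in> ctrl_points M n"
  obtains k i j where "(k, i, j) \<in> positions M n" "p = ctrl_of M n (k, i, j)"
  using assms unfolding ctrl_points_def ctrl_of_def quotient_def by auto

lemma ctrl_of_in_ctrl_points: "x \<in> positions M n \<Longrightarrow> ctrl_of M n x \<in> ctrl_points M n"
  unfolding ctrl_points_def ctrl_of_def by (rule quotientI)

lemma finite_ctrl_points:
  assumes "quad_mesh M"
  shows "finite (ctrl_points M n)"
proof -
  interpret quad_mesh M by (rule assms)
  have "finite (positions M n)" using finite_elems by (simp add: positions_def)
  then show ?thesis by (auto simp: ctrl_points_def quotient_def)
qed

lemma linear_coeff_at:
  assumes "quad_mesh M" "p \<in> ctrl_points M n"
  shows "linear_functional_on (smooth_space M n) (\<lambda>Z. coeff_at M n Z p)"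
  unfolding linear_functional_on_def
proof (intro ballI allI)
  fix Z W r assume Z: "Z \<in> smooth_space M n" and W: "W \<in> smooth_space M n"
  obtain k i j where x: "(k, i, j) \<in> positions M n" and p: "p = ctrl_of M n (k, i, j)"
    using assms(2) by (rule ctrl_points_cases)
  have k: "k \<in> elems M" using x by (simp add: positions_def)
  obtain c where c: "bernstein_form M n Z k c" using Z k by (auto simp: smooth_space_def)
  obtain d where d: "bernstein_form M n W k d" using W k by (auto simp: smooth_space_def)
  show "coeff_at M n (\<lambda>x. Z x + r * W x) p = coeff_at M n Z p + r * coeff_at M n W p"
    unfolding p coeff_at_ctrl_of[OF assms(1) Z x c] coeff_at_ctrl_of[OF assms(1) W x d]
    by (rule coeff_at_ctrl_of[OF assms(1) smooth_space_add_scale[OF Z W] x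
          bernstein_form_add_scale[OF c d]])
qed

text \<open>
  This translates the condition in \<^const>\<open>determining_set\<close>, that \<open>Z\<close> vanishes, into one about the
  coefficient functionals alone, to which \<open>fitting_basis\<close> applies.
\<close>

lemma zero_iff_all_coefficients_zero:
  assumes M: "quad_mesh M" and Z: "Z \<in> smooth_space M n"
  shows "(\<forall>x\<in>Omega M. Z x = 0) \<longleftrightarrow> (\<forall>p\<in>ctrl_points M n. coeff_at M n Z p = 0)"
proof -
  interpret quad_mesh M by (rule M)
  have image: "parametrisation M k ` cbox 0 1 = element M k" if "k \<in> elems M" for k
    using regular_bij[OF that] by (rule bij_betw_imp_surj_on)
  show ?thesis
  proof (intro iffI ballI)
    fix p assume zero: "\<forall>x\<in>Omega M. Z x = 0" and "p \<in> ctrl_points M n"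
    then obtain k i j where x: "(k, i, j) \<in> positions M n" and p: "p = ctrl_of M n (k, i, j)"
      by (metis ctrl_points_cases)
    have "k \<in> elems M" using x by (simp add: positions_def)
    then have "bernstein_form M n Z k (\<lambda>_ _. 0)"
      using zero image[of k] by (auto simp: bernstein_form_def Omega_def)
    then show "coeff_at M n Z p = 0" using coeff_at_ctrl_of[OF M Z x] p by simp
  next
    fix x assume zero: "\<forall>p\<in>ctrl_points M n. coeff_at M n Z p = 0" and "x \<in> Omega M"
    then obtain k w where k: "k \<in> elems M" and w: "w \<in> cbox 0 1" "x = parametrisation M k w"
      using image by (force simp: Omega_def)
    obtain c where c: "bernstein_form M n Z k c" using Z k by (auto simp: smooth_space_def)
    have "c i j = 0" if "i \<le> n" "j \<le> n" for i j
    proof -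
      have ij: "(k, i, j) \<in> positions M n" using k that by (simp add: positions_def)
      show ?thesis
        using coeff_at_ctrl_of[OF M Z ij c] ctrl_of_in_ctrl_points[OF ij] zero by simp
    qed
    then show "Z x = 0" using c w by (simp add: bernstein_form_def)
  qed
qed

lemma fixed_ctrls_subset:
  assumes "n \<ge> 1"
  shows "fixed_ctrls M n T \<subseteq> ctrl_points M n"
proof -
  have edge: "ctrl_of M n (k, edge_index n i m) \<in> ctrl_points M n"
    if "k \<in> elems M" "i < 4" "m \<le> n" for k i m
    using edge_index_le[OF that(2,3)] that(1)
    by (intro ctrl_of_in_ctrl_points) (simp add: positions_def)
  have "vertex_ctrls M n \<subseteq> ctrl_points M n"
    unfolding vertex_ctrls_def by (auto intro: edge)
  moreover have "tangent_ctrls M n \<subseteq> ctrl_points M n"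
    unfolding tangent_ctrls_def using assms by (auto intro!: edge)
  moreover have "boundary_ctrls M n \<subseteq> ctrl_points M n"
    unfolding boundary_ctrls_def by (auto intro: edge)
  moreover have "adjacent_row_ctrls M n \<subseteq> ctrl_points M n"
    unfolding adjacent_row_ctrls_def
    by (auto intro!: ctrl_of_in_ctrl_points simp: positions_def)
  ultimately show ?thesis by (cases T) auto
qed

theorem lemma24:
  fixes M :: "'e mesh" and n :: nat and T :: constraint_type
  assumes "quad_mesh M" and "n \<ge> 5"
  shows "\<exists>B. minimal_determining_set M n B \<and> fits M n B (fixed_ctrls M n T)"
proof -
  let ?V = "smooth_space M n" and ?P = "ctrl_points M n" and ?F = "fixed_ctrls M n T"
  let ?L = "\<lambda>p Z. coeff_at M n Z p"
  note zero = zero_iff_all_coefficients_zero[OF assms(1)]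
  have F: "?F \<subseteq> ?P" using assms(2) by (intro fixed_ctrls_subset) simp
  have lin: "\<forall>p\<in>?P. linear_functional_on ?V (?L p)"
    using linear_coeff_at[OF assms(1)] by blast
  obtain B where B: "B \<subseteq> ?P"
    and gen: "\<forall>p\<in>?P. \<exists>a. \<forall>Z\<in>?V. ?L p Z = (\<Sum>b\<in>B. a b * ?L b Z)"
    and fit: "\<forall>p\<in>?F. \<exists>a. \<forall>Z\<in>?V. ?L p Z = (\<Sum>b\<in>B \<inter> ?F. a b * ?L b Z)"
    and min: "\<forall>D\<subseteq>?P. (\<forall>Z\<in>?V. (\<forall>d\<in>D. ?L d Z = 0) \<longrightarrow> (\<forall>p\<in>?P. ?L p Z = 0))
      \<longrightarrow> card B \<le> card D"
    using fitting_basis[where L = ?L, OF finite_ctrl_points[OF assms(1)] F subspace_smooth_space lin]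
    by (elim exE conjE) (rule that; assumption)
  have "determining_set M n B"
    unfolding determining_set_def
  proof (intro conjI ballI impI)
    fix Z x assume Z: "Z \<in> ?V" and B0: "\<forall>p\<in>B. ?L p Z = 0" and x: "x \<in> Omega M"
    have "?L p Z = 0" if p: "p \<in> ?P" for p
    proof -
      obtain a where "?L p Z = (\<Sum>b\<in>B. a b * ?L b Z)" using gen p Z by blast
      then show ?thesis using B0 by simp
    qed
    then show "Z x = 0" using zero[OF Z] x by blast
  qed (rule B)
  moreover have "card B \<le> card D" if "determining_set M n D" for D
  proof -
    have "\<forall>Z\<in>?V. (\<forall>d\<in>D. ?L d Z = 0) \<longrightarrow> (\<forall>p\<in>?P. ?L p Z = 0)"
      using that zero unfolding determining_set_def by blast
    then show ?thesis using that min unfolding determining_set_def by blast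
  qed
  ultimately have "minimal_determining_set M n B"
    unfolding minimal_determining_set_def by blast
  moreover have "fits M n B ?F"
    unfolding fits_def using fit by blast
  ultimately show ?thesis by blast
qed

end
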